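(* Let $(L,\wedge,\vee,0,1,\to)$ be an Ex-algebra. Then there are an orthomodular algebra $O_L$, a Heyting algebra $I_L$, and a subdirect fundamental algebra embedding $e:L\to O_L\times I_L$, i.e. an injective map preserving $\wedge,\vee,0,1,\to$ (with componentwise operations on the product) such that the compositions $\pi_1\circ e:L\to O_L$ and $\pi_2\circ e:L\to I_L$ with the two projections are surjective.
   Context: A fundamental algebra is a structure $(L,\wedge,\vee,0,1,\to)$ such that $(L,\wedge,\vee,0,1)$ is a bounded lattice, $\to$ is a binary operation, and, with $\lnot a:=a\to 0$, for all $a,b\in L$: (i) $a\leq b$ implies $\lnot b\leq\lnot a$; (ii) $a\wedge\lnot a=0$; (iii) $a\leq\lnot\lnot a$. An orthomodular algebra is a fundamental algebra such that for all $a,b$: $\lnot\lnot a=a$, $a\wedge(a\to b)\leq b$, and $a\to b=\lnot a\vee(a\wedge b)$. A Heyting algebra is a fundamental algebra satisfying, for all $a,b,c$: $c\wedge a\leq b$ iff $c\leq a\to b$. An Ex-algebra is a fundamental algebra satisfying, for all elements: (iEx) $\big[\big(a\wedge((b\wedge c)\vee(b\wedge d))\big)\to g\big]\wedge a\wedge(c\vee e)\wedge\lnot\lnot f\leq\lnot\lnot(a\wedge f)\wedge\big[(a\wedge c)\vee(a\wedge e)\vee f\big]\wedge\big[(b\wedge(c\vee d))\vee\big((b\wedge(c\vee d))\to g\big)\big]$; (nS) $\lnot(a\to b)=\lnot(\lnot a\vee(a\wedge b))$; (MP) $a\wedge(a\to b)=a\wedge b$; (M) $(a\wedge b)\to b=1$;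 (W4) $a\to(b\wedge c)\leq a\to b$. *)

theory Defs
  imports "HOL-Algebra.Lattice"
begin

text \<open>
  The lattice part is HOL-Algebra's \<^locale>\<open>bounded_lattice\<close>: it is presented by its order, the
  operations join, meet, bottom and top being the ones determined by that order. Only the
  implication has to be added to the signature.
\<close>

record 'a fund_alg = "'a gorder" +
  imp :: "['a, 'a] \<Rightarrow> 'a" (infixr \<open>\<rightharpoonup>\<index>\<close> 60)

definition neg :: "[_, 'a] \<Rightarrow> 'a" (\<open>\<sim>\<index> _\<close> [80] 80)
  where "\<sim>\<^bsub>L\<^esub> a = a \<rightharpoonup>\<^bsub>L\<^esub> \<bottom>\<^bsub>L\<^esub>"

locale fundamental_algebra = bounded_lattice L for L :: "('a, 'm) fund_alg_scheme" (structure) +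
  assumes imp_closed [simp, intro]:
      "\<lbrakk>a \<in> carrier L; b \<in> carrier L\<rbrakk> \<Longrightarrow> a \<rightharpoonup> b \<in> carrier L"
    and neg_antitone:
      "\<lbrakk>a \<in> carrier L; b \<in> carrier L; a \<sqsubseteq> b\<rbrakk> \<Longrightarrow> \<sim> b \<sqsubseteq> \<sim> a"
    and meet_neg: "a \<in> carrier L \<Longrightarrow> a \<sqinter> \<sim> a = \<bottom>"
    and le_neg_neg: "a \<in> carrier L \<Longrightarrow> a \<sqsubseteq> \<sim> \<sim> a"

locale orthomodular_algebra = fundamental_algebra +
  assumes neg_neg: "a \<in> carrier L \<Longrightarrow> \<sim> \<sim> a = a"
    and modus_ponens: "\<lbrakk>a \<in> carrier L; b \<in> carrier L\<rbrakk> \<Longrightarrow> a \<sqinter> (a \<rightharpoonup> b) \<sqsubseteq> b"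
    and imp_eq: "\<lbrakk>a \<in> carrier L; b \<in> carrier L\<rbrakk> \<Longrightarrow> a \<rightharpoonup> b = \<sim> a \<squnion> (a \<sqinter> b)"

locale heyting_algebra = fundamental_algebra +
  assumes residuation:
    "\<lbrakk>a \<in> carrier L; b \<in> carrier L; c \<in> carrier L\<rbrakk> \<Longrightarrow> c \<sqinter> a \<sqsubseteq> b \<longleftrightarrow> c \<sqsubseteq> a \<rightharpoonup> b"

locale ex_algebra = fundamental_algebra +
  assumes iEx:
      "\<lbrakk>a \<in> carrier L; b \<in> carrier L; c \<in> carrier L; d \<in> carrier L;
        e \<in> carrier L; f \<in> carrier L; g \<in> carrier L\<rbrakk> \<Longrightarrow>
       ((a \<sqinter> ((b \<sqinter> c) \<squnion> (b \<sqinter> d))) \<rightharpoonup> g) \<sqinter> a \<sqinter> (c \<squnion> e) \<sqinter> \<sim> \<sim> f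
       \<sqsubseteq> \<sim> \<sim> (a \<sqinter> f) \<sqinter> ((a \<sqinter> c) \<squnion> (a \<sqinter> e) \<squnion> f)
          \<sqinter> ((b \<sqinter> (c \<squnion> d)) \<squnion> ((b \<sqinter> (c \<squnion> d)) \<rightharpoonup> g))"
    and nS: "\<lbrakk>a \<in> carrier L; b \<in> carrier L\<rbrakk> \<Longrightarrow> \<sim> (a \<rightharpoonup> b) = \<sim> (\<sim> a \<squnion> (a \<sqinter> b))"
    and MP: "\<lbrakk>a \<in> carrier L; b \<in> carrier L\<rbrakk> \<Longrightarrow> a \<sqinter> (a \<rightharpoonup> b) = a \<sqinter> b"
    and M: "\<lbrakk>a \<in> carrier L; b \<in> carrier L\<rbrakk> \<Longrightarrow> (a \<sqinter> b) \<rightharpoonup> b = \<top>"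
    and W4: "\<lbrakk>a \<in> carrier L; b \<in> carrier L; c \<in> carrier L\<rbrakk> \<Longrightarrow> a \<rightharpoonup> (b \<sqinter> c) \<sqsubseteq> a \<rightharpoonup> b"

definition fund_hom ::
    "[('a, 'm) fund_alg_scheme, ('b, 'n) fund_alg_scheme] \<Rightarrow> ('a \<Rightarrow> 'b) set"
  where "fund_hom A B =
    {h \<in> carrier A \<rightarrow> carrier B.
       (\<forall>x \<in> carrier A. \<forall>y \<in> carrier A.
          h (x \<sqinter>\<^bsub>A\<^esub> y) = h x \<sqinter>\<^bsub>B\<^esub> h y \<and>
          h (x \<squnion>\<^bsub>A\<^esub> y) = h x \<squnion>\<^bsub>B\<^esub> h y \<and>
          h (x \<rightharpoonup>\<^bsub>A\<^esub> y) = h x \<rightharpoonup>\<^bsub>B\<^esub> h y) \<and>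
       h \<bottom>\<^bsub>A\<^esub> = \<bottom>\<^bsub>B\<^esub> \<and> h \<top>\<^bsub>A\<^esub> = \<top>\<^bsub>B\<^esub>}"

definition fund_prod ::
    "[('a, 'm) fund_alg_scheme, ('b, 'n) fund_alg_scheme] \<Rightarrow> ('a \<times> 'b) fund_alg"
  where "fund_prod A B =
    \<lparr>carrier = carrier A \<times> carrier B,
     eq = (=),
     le = (\<lambda>p q. fst p \<sqsubseteq>\<^bsub>A\<^esub> fst q \<and> snd p \<sqsubseteq>\<^bsub>B\<^esub> snd q),
     imp = (\<lambda>p q. (fst p \<rightharpoonup>\<^bsub>A\<^esub> fst q, snd p \<rightharpoonup>\<^bsub>B\<^esub> snd q))\<rparr>"

definition subdirect_embedding ::
    "[('a, 'l) fund_alg_scheme, ('b, 'm) fund_alg_scheme, ('c, 'n) fund_alg_scheme,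
      'a \<Rightarrow> 'b \<times> 'c] \<Rightarrow> bool"
  where "subdirect_embedding L A B h \<longleftrightarrow>
    h \<in> fund_hom L (fund_prod A B) \<and> inj_on h (carrier L) \<and>
    (fst \<circ> h) ` carrier L = carrier A \<and> (snd \<circ> h) ` carrier L = carrier B"

lemma fund_prod_carrier [simp]: "carrier (fund_prod A B) = carrier A \<times> carrier B"
  by (simp add: fund_prod_def)

lemma fund_prod_le [simp]:
  "p \<sqsubseteq>\<^bsub>fund_prod A B\<^esub> q \<longleftrightarrow> fst p \<sqsubseteq>\<^bsub>A\<^esub> fst q \<and> snd p \<sqsubseteq>\<^bsub>B\<^esub> snd q"
  by (simp add: fund_prod_def)

lemma fund_prod_imp [simp]:
  "p \<rightharpoonup>\<^bsub>fund_prod A B\<^esub> q = (fst p \<rightharpoonup>\<^bsub>A\<^esub> fst q, snd p \<rightharpoonup>\<^bsub>B\<^esub> snd q)"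
  by (simp add: fund_prod_def)

lemma fund_prod_eq: "(.=\<^bsub>fund_prod A B\<^esub>) = (=)"
  by (simp add: fund_prod_def)

text \<open>
  The operations of the product, which are determined by its order, are the componentwise ones.
\<close>

context
  fixes A :: "('a, 'm) fund_alg_scheme" and B :: "('b, 'n) fund_alg_scheme"
  assumes A: "fundamental_algebra A" and B: "fundamental_algebra B"
begin

interpretation A: fundamental_algebra A by (fact A)
interpretation B: fundamental_algebra B by (fact B)

lemma fund_prod_partial_order: "partial_order (fund_prod A B)"
proof
  fix p q r
  assume "p \<sqsubseteq>\<^bsub>fund_prod A B\<^esub> q" "q \<sqsubseteq>\<^bsub>fund_prod A B\<^esub> r"
    "p \<in> carrier (fund_prod A B)" "q \<in> carrier (fund_prod A B)" "r \<in> carrier (fund_prod A B)"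
  then show "p \<sqsubseteq>\<^bsub>fund_prod A B\<^esub> r"
    by (auto dest: A.le_trans B.le_trans)
next
  fix p q
  assume "p \<sqsubseteq>\<^bsub>fund_prod A B\<^esub> q" "q \<sqsubseteq>\<^bsub>fund_prod A B\<^esub> p"
    "p \<in> carrier (fund_prod A B)" "q \<in> carrier (fund_prod A B)"
  then show "p .=\<^bsub>fund_prod A B\<^esub> q"
    by (auto simp: fund_prod_eq dest: A.le_antisym B.le_antisym)
qed (auto simp: fund_prod_eq)

lemma fund_prod_least_upper:
  assumes "p \<in> carrier A \<times> carrier B" "q \<in> carrier A \<times> carrier B"
  shows "least (fund_prod A B) (fst p \<squnion>\<^bsub>A\<^esub> fst q, snd p \<squnion>\<^bsub>B\<^esub> snd q) (Upper (fund_prod A B) {p, q})"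
  using assms
  by (auto simp: least_def Upper_def
      intro: A.join_left A.join_right A.join_le B.join_left B.join_right B.join_le)

lemma fund_prod_greatest_lower:
  assumes "p \<in> carrier A \<times> carrier B" "q \<in> carrier A \<times> carrier B"
  shows "greatest (fund_prod A B) (fst p \<sqinter>\<^bsub>A\<^esub> fst q, snd p \<sqinter>\<^bsub>B\<^esub> snd q) (Lower (fund_prod A B) {p, q})"
  using assms
  by (auto simp: greatest_def Lower_def
      intro: A.meet_left A.meet_right A.meet_le B.meet_left B.meet_right B.meet_le)

lemma fund_prod_least: "least (fund_prod A B) (\<bottom>\<^bsub>A\<^esub>, \<bottom>\<^bsub>B\<^esub>) (carrier (fund_prod A B))"
  by (auto simp: least_def)

lemma fund_prod_greatest: "greatest (fund_prod A B) (\<top>\<^bsub>A\<^esub>, \<top>\<^bsub>B\<^esub>) (carrier (fund_prod A B))"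
  by (auto simp: greatest_def)

lemma fund_prod_bounded_lattice: "bounded_lattice (fund_prod A B)"
proof -
  interpret P: partial_order "fund_prod A B" by (fact fund_prod_partial_order)
  show ?thesis
    by unfold_locales
      (metis fund_prod_carrier fund_prod_least_upper fund_prod_greatest_lower
        fund_prod_least fund_prod_greatest)+
qed

interpretation P: bounded_lattice "fund_prod A B" by (fact fund_prod_bounded_lattice)

lemma fund_prod_join:
  assumes "p \<in> carrier A \<times> carrier B" "q \<in> carrier A \<times> carrier B"
  shows "p \<squnion>\<^bsub>fund_prod A B\<^esub> q = (fst p \<squnion>\<^bsub>A\<^esub> fst q, snd p \<squnion>\<^bsub>B\<^esub> snd q)"
  using fund_prod_least_upper[OF assms] unfolding join_def sup_def
  by (metis P.least_unique someI)

lemma fund_prod_meet: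
  assumes "p \<in> carrier A \<times> carrier B" "q \<in> carrier A \<times> carrier B"
  shows "p \<sqinter>\<^bsub>fund_prod A B\<^esub> q = (fst p \<sqinter>\<^bsub>A\<^esub> fst q, snd p \<sqinter>\<^bsub>B\<^esub> snd q)"
  using fund_prod_greatest_lower[OF assms] unfolding meet_def inf_def
  by (metis P.greatest_unique someI)

lemma fund_prod_bottom: "\<bottom>\<^bsub>fund_prod A B\<^esub> = (\<bottom>\<^bsub>A\<^esub>, \<bottom>\<^bsub>B\<^esub>)"
  by (rule P.least_unique[OF P.bottom_least fund_prod_least])

lemma fund_prod_top: "\<top>\<^bsub>fund_prod A B\<^esub> = (\<top>\<^bsub>A\<^esub>, \<top>\<^bsub>B\<^esub>)"
  by (rule P.greatest_unique[OF P.top_greatest fund_prod_greatest])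

lemma fund_prod_neg: "\<sim>\<^bsub>fund_prod A B\<^esub> p = (\<sim>\<^bsub>A\<^esub> fst p, \<sim>\<^bsub>B\<^esub> snd p)"
  by (simp add: neg_def fund_prod_bottom)

lemma fund_prod_fundamental_algebra: "fundamental_algebra (fund_prod A B)"
proof
  fix p q
  assume p: "p \<in> carrier (fund_prod A B)"
  have n: "\<sim>\<^bsub>A\<^esub> fst p \<in> carrier A" "\<sim>\<^bsub>B\<^esub> snd p \<in> carrier B"
    using p by (auto simp: neg_def)
  show "p \<sqinter>\<^bsub>fund_prod A B\<^esub> \<sim>\<^bsub>fund_prod A B\<^esub> p = \<bottom>\<^bsub>fund_prod A B\<^esub>"
    using p n by (auto simp: fund_prod_neg fund_prod_meet fund_prod_bottom A.meet_neg B.meet_neg)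
  show "p \<sqsubseteq>\<^bsub>fund_prod A B\<^esub> \<sim>\<^bsub>fund_prod A B\<^esub> \<sim>\<^bsub>fund_prod A B\<^esub> p"
    using p by (auto simp: fund_prod_neg A.le_neg_neg B.le_neg_neg)
  assume q: "q \<in> carrier (fund_prod A B)"
  show "p \<rightharpoonup>\<^bsub>fund_prod A B\<^esub> q \<in> carrier (fund_prod A B)"
    using p q by auto
  assume "p \<sqsubseteq>\<^bsub>fund_prod A B\<^esub> q"
  then show "\<sim>\<^bsub>fund_prod A B\<^esub> q \<sqsubseteq>\<^bsub>fund_prod A B\<^esub> \<sim>\<^bsub>fund_prod A B\<^esub> p"
    using p q by (auto simp: fund_prod_neg intro: A.neg_antitone B.neg_antitone)
qed

end

end

theory Submission
  imports Defs
begin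

text \<open>
  The orthomodular and the Heyting algebra are quotients of \<open>L\<close>, by the congruences induced by two
  preorders. For the orthomodular one it is \<open>x \<le> \<not>\<not>y\<close>. For the Heyting one, the
  distributivity contained in (iEx) is read as a cut rule: if \<open>a \<le> c \<or> d\<close>, \<open>a \<le> \<not>\<not>f\<close>,
  \<open>a \<and> c \<le> f\<close> and \<open>a \<and> d \<le> f\<close>, then \<open>a \<le> f\<close>. Put \<open>x \<preceq> y\<close> if \<open>y\<close> can be cut against \<open>x\<close>, that is,
  \<open>a \<le> x\<close>, \<open>a \<le> \<not>\<not>f\<close> and \<open>a \<and> y \<le> f\<close> imply \<open>a \<le> f\<close>, and moreover \<open>x \<or> (x \<rightarrow> y) = 1\<close>. Elements of
  the form \<open>x \<or> (x \<rightarrow> y)\<close> are dense, so the cut rule applies to them without restriction, and this makes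
  \<open>\<preceq>\<close> a lattice preorder for which \<open>\<rightarrow>\<close> is residual to \<open>\<and>\<close>. Finally \<open>x \<preceq> y\<close> and \<open>x \<le> \<not>\<not>y\<close> give
  \<open>x \<le> y\<close>, by taking \<open>a = x\<close> and \<open>f = y\<close>, so the two quotients together separate elements.
\<close>

section \<open>Order and negation in a fundamental algebra\<close>

context fundamental_algebra
begin

lemma neg_closed [simp, intro]: "a \<in> carrier L \<Longrightarrow> \<sim> a \<in> carrier L"
  by (simp add: neg_def)

lemma le_join1: "\<lbrakk>x \<sqsubseteq> a; x \<in> carrier L; a \<in> carrier L; b \<in> carrier L\<rbrakk> \<Longrightarrow> x \<sqsubseteq> a \<squnion> b"
  by (meson join_closed join_left le_trans)

lemma le_join2: "\<lbrakk>x \<sqsubseteq> b; x \<in> carrier L; a \<in> carrier L; b \<in> carrier L\<rbrakk> \<Longrightarrow> x \<sqsubseteq> a \<squnion> b"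
  by (meson join_closed join_right le_trans)

lemma meet_le1: "\<lbrakk>a \<sqsubseteq> x; x \<in> carrier L; a \<in> carrier L; b \<in> carrier L\<rbrakk> \<Longrightarrow> a \<sqinter> b \<sqsubseteq> x"
  by (meson meet_closed meet_left le_trans)

lemma meet_le2: "\<lbrakk>b \<sqsubseteq> x; x \<in> carrier L; a \<in> carrier L; b \<in> carrier L\<rbrakk> \<Longrightarrow> a \<sqinter> b \<sqsubseteq> x"
  by (meson meet_closed meet_right le_trans)

lemma eq_top: "\<lbrakk>\<top> \<sqsubseteq> a; a \<in> carrier L\<rbrakk> \<Longrightarrow> a = \<top>"
  using top_higher by (auto intro!: le_antisym)

lemma eq_bottom: "\<lbrakk>a \<sqsubseteq> \<bottom>; a \<in> carrier L\<rbrakk> \<Longrightarrow> a = \<bottom>"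
  using bottom_lower by (auto intro!: le_antisym)

lemma le_neg_swap: "\<lbrakk>a \<sqsubseteq> \<sim> b; a \<in> carrier L; b \<in> carrier L\<rbrakk> \<Longrightarrow> b \<sqsubseteq> \<sim> a"
  by (meson le_neg_neg le_trans neg_antitone neg_closed)

lemma neg_neg_neg: "a \<in> carrier L \<Longrightarrow> \<sim> \<sim> \<sim> a = \<sim> a"
  by (simp add: le_antisym le_neg_neg neg_antitone)

lemma neg_neg_mono: "\<lbrakk>a \<sqsubseteq> b; a \<in> carrier L; b \<in> carrier L\<rbrakk> \<Longrightarrow> \<sim> \<sim> a \<sqsubseteq> \<sim> \<sim> b"
  by (simp add: neg_antitone)

lemma neg_top: "\<sim> \<top> = \<bottom>"
  using meet_neg[of \<top>] by (metis le_iff_join meet_comm neg_closed top_closed top_higher)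

lemma neg_bottom: "\<sim> \<bottom> = \<top>"
  by (metis bottom_closed eq_top le_neg_neg neg_closed neg_top top_closed)

end

section \<open>Instances of (iEx): the cut rule and dense joins\<close>

context ex_algebra
begin

lemma imp_eq_top: "\<lbrakk>a \<sqsubseteq> b; a \<in> carrier L; b \<in> carrier L\<rbrakk> \<Longrightarrow> a \<rightharpoonup> b = \<top>"
  using M[of a b] le_iff_join[of a b] by simp

lemma imp_mono: "\<lbrakk>b \<sqsubseteq> c; a \<in> carrier L; b \<in> carrier L; c \<in> carrier L\<rbrakk> \<Longrightarrow> a \<rightharpoonup> b \<sqsubseteq> a \<rightharpoonup> c"
  by (metis W4 le_iff_join meet_comm)

lemma meet_le_imp: "\<lbrakk>a \<in> carrier L; b \<in> carrier L\<rbrakk> \<Longrightarrow> a \<sqinter> b \<sqsubseteq> a \<rightharpoonup> b"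
  by (metis MP imp_closed meet_right)

lemma meet_imp_le: "\<lbrakk>a \<in> carrier L; b \<in> carrier L\<rbrakk> \<Longrightarrow> a \<sqinter> (a \<rightharpoonup> b) \<sqsubseteq> b"
  by (simp add: MP meet_right)

text \<open>The right side of (iEx) is a meet of three factors. This lemma yields the first,
  \<open>cut\<close> the second, \<open>meet_join_dichotomy\<close> and \<open>le_join_imp\<close>
  the third, by specialising variables, mostly to \<top>. Here all variables but a and f become
  \<top>.\<close>

lemma le_neg_neg_meet:
  assumes "x \<sqsubseteq> a" "x \<sqsubseteq> \<sim> \<sim> f" and [simp]: "x \<in> carrier L" "a \<in> carrier L" "f \<in> carrier L"
  shows "x \<sqsubseteq> \<sim> \<sim> (a \<sqinter> f)"
proof -
  have "x \<sqsubseteq> ((a \<sqinter> ((\<top> \<sqinter> \<top>) \<squnion> (\<top> \<sqinter> \<top>))) \<rightharpoonup> \<top>) \<sqinter> a \<sqinter> (\<top> \<squnion> \<top>) \<sqinter> \<sim> \<sim> f"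
    using assms by (simp add: imp_eq_top meet_le le_join1 top_higher)
  also note iEx[of a \<top> \<top> \<top> \<top> f \<top>]
  finally have "x \<sqsubseteq> \<sim> \<sim> (a \<sqinter> f) \<sqinter> ((a \<sqinter> \<top>) \<squnion> (a \<sqinter> \<top>) \<squnion> f)
          \<sqinter> ((\<top> \<sqinter> (\<top> \<squnion> \<top>)) \<squnion> ((\<top> \<sqinter> (\<top> \<squnion> \<top>)) \<rightharpoonup> \<top>))"
    by simp
  then show ?thesis
    by (rule le_trans) (simp_all add: meet_le1)
qed

text \<open>Distributivity holds modulo \<open>f\<close> below \<open>\<not>\<not>f\<close>.\<close>

lemma cut:
  assumes "a \<sqsubseteq> c \<squnion> d" "a \<sqsubseteq> \<sim> \<sim> f" "a \<sqinter> c \<sqsubseteq> f" "a \<sqinter> d \<sqsubseteq> f"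
    and [simp]: "a \<in> carrier L" "c \<in> carrier L" "d \<in> carrier L" "f \<in> carrier L"
  shows "a \<sqsubseteq> f"
proof -
  have "a \<sqsubseteq> ((a \<sqinter> ((\<top> \<sqinter> c) \<squnion> (\<top> \<sqinter> \<top>))) \<rightharpoonup> \<top>) \<sqinter> a \<sqinter> (c \<squnion> d) \<sqinter> \<sim> \<sim> f"
    using assms by (simp add: imp_eq_top meet_le le_join1 top_higher)
  also note iEx[of a \<top> c \<top> d f \<top>]
  finally have "a \<sqsubseteq> \<sim> \<sim> (a \<sqinter> f) \<sqinter> ((a \<sqinter> c) \<squnion> (a \<sqinter> d) \<squnion> f)
          \<sqinter> ((\<top> \<sqinter> (c \<squnion> \<top>)) \<squnion> ((\<top> \<sqinter> (c \<squnion> \<top>)) \<rightharpoonup> \<top>))"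
    by simp
  then show ?thesis
    by (rule le_trans) (simp_all add: meet_le1 meet_le2 join_le assms)
qed

text \<open>Take \<top> for a, e and f in (iEx). The first two hypotheses turn the implication on
  the left into \<top>, and the third turns b \<and> (c \<or> d) on the right into b. Without
  distributivity b itself need not be below g.\<close>

lemma meet_join_dichotomy:
  assumes "b \<sqinter> c \<sqsubseteq> g" "b \<sqinter> d \<sqsubseteq> g" "b \<sqsubseteq> c \<squnion> d"
    and [simp]: "b \<in> carrier L" "c \<in> carrier L" "d \<in> carrier L" "g \<in> carrier L"
  shows "\<top> \<sqsubseteq> b \<squnion> (b \<rightharpoonup> g)"
proof -
  have b: "b \<sqinter> (c \<squnion> d) = b"
    using assms le_iff_join[of b "c \<squnion> d"] by simp
  have "\<top> \<sqsubseteq> ((\<top> \<sqinter> ((b \<sqinter> c) \<squnion> (b \<sqinter> d))) \<rightharpoonup> g) \<sqinter> \<top> \<sqinter> (c \<squnion> \<top>) \<sqinter> \<sim> \<sim> \<top>"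
    using assms by (simp add: imp_eq_top meet_le le_join2 join_le meet_le2 neg_top neg_bottom)
  also note iEx[of \<top> b c d \<top> \<top> g]
  finally have "\<top> \<sqsubseteq> \<sim> \<sim> (\<top> \<sqinter> \<top>) \<sqinter> ((\<top> \<sqinter> c) \<squnion> (\<top> \<sqinter> \<top>) \<squnion> \<top>)
          \<sqinter> (b \<squnion> (b \<rightharpoonup> g))"
    using b by simp
  then show ?thesis
    by (rule le_trans) (simp_all add: meet_le2)
qed

text \<open>A weak residuation: a gets below b \<rightarrow> c only up to a join with b. In (iEx)
  the variables c and d become b, and g becomes c; the hypothesis makes the implication on the left
  \<top>.\<close>

lemma le_join_imp:
  assumes "a \<sqinter> b \<sqsubseteq> c" and [simp]: "a \<in> carrier L" "b \<in> carrier L" "c \<in> carrier L"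
  shows "a \<sqsubseteq> b \<squnion> (b \<rightharpoonup> c)"
proof -
  have b: "b \<sqinter> b \<squnion> b \<sqinter> b = b" "b \<sqinter> (b \<squnion> b) = b"
    by (intro le_antisym; simp add: le_join1 join_le meet_le meet_le1)+
  have "a \<sqsubseteq> ((a \<sqinter> ((b \<sqinter> b) \<squnion> (b \<sqinter> b))) \<rightharpoonup> c) \<sqinter> a \<sqinter> (b \<squnion> \<top>) \<sqinter> \<sim> \<sim> \<top>"
    using assms by (simp add: b imp_eq_top meet_le le_join2 neg_top neg_bottom top_higher)
  also note iEx[of a b b b \<top> \<top> c]
  finally have "a \<sqsubseteq> \<sim> \<sim> (a \<sqinter> \<top>) \<sqinter> ((a \<sqinter> b) \<squnion> (a \<sqinter> \<top>) \<squnion> \<top>)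
          \<sqinter> (b \<squnion> (b \<rightharpoonup> c))"
    by (simp add: b)
  then show ?thesis
    by (rule le_trans) (simp_all add: meet_le2)
qed

text \<open>Since \<not>a is below a \<rightarrow> b, the negation of the join is below both \<not>a
  and \<not>\<not>a, whose meet is \<bottom>.\<close>

lemma join_imp_dense:
  assumes "a \<in> carrier L" "b \<in> carrier L"
  shows "\<sim> \<sim> (a \<squnion> (a \<rightharpoonup> b)) = \<top>"
proof -
  let ?f = "a \<squnion> (a \<rightharpoonup> b)"
  have "\<sim> a \<sqsubseteq> a \<rightharpoonup> b"
    using assms by (simp add: neg_def imp_mono)
  then have "\<sim> ?f \<sqsubseteq> \<sim> a" "\<sim> ?f \<sqsubseteq> \<sim> \<sim> a"
    using assms by (simp_all add: neg_antitone le_join1 le_join2)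
  then have "\<sim> ?f \<sqsubseteq> \<bottom>"
    using assms meet_neg[of "\<sim> a"] meet_le[of "\<sim> ?f" "\<sim> a" "\<sim> \<sim> a"] by simp
  then have "\<sim> ?f = \<bottom>"
    using assms by (intro eq_bottom) simp_all
  then show ?thesis
    by (simp add: neg_bottom)
qed

lemma cut_dense:
  assumes "a \<sqsubseteq> c \<squnion> d" "a \<sqinter> c \<sqsubseteq> x \<squnion> (x \<rightharpoonup> y)" "a \<sqinter> d \<sqsubseteq> x \<squnion> (x \<rightharpoonup> y)"
    and "a \<in> carrier L" "c \<in> carrier L" "d \<in> carrier L" "x \<in> carrier L" "y \<in> carrier L"
  shows "a \<sqsubseteq> x \<squnion> (x \<rightharpoonup> y)"
  by (rule cut[OF assms(1) _ assms(2,3)]) (simp_all add: join_imp_dense assms)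

text \<open>With distributivity the cases would give p \<and> x \<le> g, and
  \<open>le_join_imp\<close> would suffice. Instead p is cut along b \<or> (b \<rightarrow> g) for b
  = p \<and> x, which is \<top> by \<open>meet_join_dichotomy\<close>: the first part is below x,
  the second yields g after a meet with x.\<close>

lemma le_join_imp_cases:
  assumes "p \<sqinter> x \<sqsubseteq> c \<squnion> d" "p \<sqinter> x \<sqinter> c \<sqsubseteq> g" "p \<sqinter> x \<sqinter> d \<sqsubseteq> g"
    and [simp]: "p \<in> carrier L" "x \<in> carrier L" "c \<in> carrier L" "d \<in> carrier L" "g \<in> carrier L"
  shows "p \<sqsubseteq> x \<squnion> (x \<rightharpoonup> g)"
proof (rule cut_dense)
  let ?b = "p \<sqinter> x"
  show "p \<sqsubseteq> ?b \<squnion> (?b \<rightharpoonup> g)"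
    using meet_join_dichotomy[of ?b c g d] assms by (meson top_higher le_trans top_closed imp_closed join_closed meet_closed)
  show "p \<sqinter> ?b \<sqsubseteq> x \<squnion> (x \<rightharpoonup> g)"
    by (simp add: le_join1 meet_le2)
  have "p \<sqinter> (?b \<rightharpoonup> g) \<sqinter> x \<sqsubseteq> ?b \<sqinter> (?b \<rightharpoonup> g)"
    by (intro meet_le) (simp_all add: meet_le1 meet_le2)
  also have "\<dots> \<sqsubseteq> g"
    by (simp add: meet_imp_le)
  finally show "p \<sqinter> (?b \<rightharpoonup> g) \<sqsubseteq> x \<squnion> (x \<rightharpoonup> g)"
    by (simp add: le_join_imp)
qed simp_all

section \<open>The Heyting preorder\<close>

text \<open>
  In an orthomodular algebra both conditions hold for all \<open>x\<close> and \<open>y\<close>, so only Heyting components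
  are compared. The second condition alone is not compatible with the implication: in the chain
  \<open>0 < m < 1\<close> it identifies \<open>m\<close> with \<open>0\<close>.
\<close>

definition heyting_le where
  "heyting_le x y \<longleftrightarrow> \<top> \<sqsubseteq> x \<squnion> (x \<rightharpoonup> y) \<and>
    (\<forall>a \<in> carrier L. \<forall>f \<in> carrier L. a \<sqsubseteq> x \<longrightarrow> a \<sqsubseteq> \<sim> \<sim> f \<longrightarrow> a \<sqinter> y \<sqsubseteq> f \<longrightarrow> a \<sqsubseteq> f)"

lemma heyting_leD:
  assumes "heyting_le x y" "a \<sqsubseteq> x" "a \<sqsubseteq> \<sim> \<sim> f" "a \<sqinter> y \<sqsubseteq> f" "a \<in> carrier L" "f \<in> carrier L"
  shows "a \<sqsubseteq> f"
  using assms by (auto simp: heyting_le_def)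

lemma heyting_le_cover:
  assumes "heyting_le x y" "a \<in> carrier L" "x \<in> carrier L" "y \<in> carrier L"
  shows "a \<sqsubseteq> x \<squnion> (x \<rightharpoonup> y)"
  using assms top_higher le_trans unfolding heyting_le_def
  by (meson imp_closed join_closed top_closed)

lemma heyting_leI:
  assumes "\<top> \<sqsubseteq> x \<squnion> (x \<rightharpoonup> y)"
    and "\<And>a f. \<lbrakk>a \<in> carrier L; f \<in> carrier L; a \<sqsubseteq> x; a \<sqsubseteq> \<sim> \<sim> f; a \<sqinter> y \<sqsubseteq> f\<rbrakk> \<Longrightarrow> a \<sqsubseteq> f"
  shows "heyting_le x y"
  using assms by (auto simp: heyting_le_def)

lemma le_imp_heyting_le:
  assumes "x \<sqsubseteq> y" and [simp]: "x \<in> carrier L" "y \<in> carrier L"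
  shows "heyting_le x y"
proof (rule heyting_leI)
  show "\<top> \<sqsubseteq> x \<squnion> (x \<rightharpoonup> y)"
    using assms by (simp add: imp_eq_top le_join2)
  fix a f
  assume a: "a \<in> carrier L" "f \<in> carrier L" "a \<sqsubseteq> x" "a \<sqinter> y \<sqsubseteq> f"
  then have "a \<sqsubseteq> a \<sqinter> y"
    using le_trans[OF a(3) assms(1)] by (simp add: meet_le)
  then show "a \<sqsubseteq> f"
    using a le_trans by (meson assms(3) meet_closed)
qed

text \<open>For the first condition x \<or> (x \<rightarrow> y) is \<top>, so only x \<rightarrow> y
  has to be put below \<open>?f\<close>; it is cut along y \<or> (y \<rightarrow> z). For the
  second, z is cut against y below a, and then y against x.\<close>

lemma heyting_le_trans:
  assumes xy: "heyting_le x y" and yz: "heyting_le y z"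
    and [simp]: "x \<in> carrier L" "y \<in> carrier L" "z \<in> carrier L"
  shows "heyting_le x z"
proof (rule heyting_leI)
  let ?f = "x \<squnion> (x \<rightharpoonup> z)"
  have z: "z \<sqsubseteq> ?f"
    by (simp add: le_join_imp meet_le1)
  \<comment> \<open>The cut property in \<open>yz\<close> applies with f taken to be
    \<open>?f\<close>, because \<open>?f\<close> is dense.\<close>
  have y: "y \<sqsubseteq> ?f"
    by (rule heyting_leD[OF yz]) (simp_all add: join_imp_dense meet_le2 z)
  have xy': "x \<rightharpoonup> y \<sqsubseteq> ?f"
  proof (rule cut_dense)
    show "x \<rightharpoonup> y \<sqsubseteq> y \<squnion> (y \<rightharpoonup> z)"
      by (rule heyting_le_cover[OF yz]) simp_all
    show "(x \<rightharpoonup> y) \<sqinter> y \<sqsubseteq> ?f"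
      by (simp add: y meet_le2)
    have "(x \<rightharpoonup> y) \<sqinter> (y \<rightharpoonup> z) \<sqinter> x \<sqsubseteq> y \<sqinter> (y \<rightharpoonup> z)"
    proof (rule meet_le)
      have "(x \<rightharpoonup> y) \<sqinter> (y \<rightharpoonup> z) \<sqinter> x \<sqsubseteq> x \<sqinter> (x \<rightharpoonup> y)"
        by (simp add: meet_le meet_le1 meet_le2)
      then show "(x \<rightharpoonup> y) \<sqinter> (y \<rightharpoonup> z) \<sqinter> x \<sqsubseteq> y"
        by (rule le_trans) (simp_all add: meet_imp_le)
    qed (simp_all add: meet_le1 meet_le2)
    then have "(x \<rightharpoonup> y) \<sqinter> (y \<rightharpoonup> z) \<sqinter> x \<sqsubseteq> z"
      by (rule le_trans) (simp_all add: meet_imp_le)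
    then show "(x \<rightharpoonup> y) \<sqinter> (y \<rightharpoonup> z) \<sqsubseteq> ?f"
      by (simp add: le_join_imp)
  qed simp_all
  have "x \<squnion> (x \<rightharpoonup> y) \<sqsubseteq> ?f"
    using xy' by (simp add: join_le join_left)
  then show "\<top> \<sqsubseteq> ?f"
    using le_trans[OF heyting_le_cover[OF xy, of \<top>]] by simp
  fix a f
  assume a [simp]: "a \<in> carrier L" "f \<in> carrier L" and *: "a \<sqsubseteq> x" "a \<sqsubseteq> \<sim> \<sim> f" "a \<sqinter> z \<sqsubseteq> f"
  show "a \<sqsubseteq> f"
  proof (rule heyting_leD[OF xy])
    have "a \<sqinter> y \<sqinter> z \<sqsubseteq> a \<sqinter> z"
      by (simp add: meet_le meet_le1 meet_le2)
    then have "a \<sqinter> y \<sqinter> z \<sqsubseteq> f"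
      by (rule le_trans) (simp_all add: *)
    from heyting_leD[OF yz _ _ this] show "a \<sqinter> y \<sqsubseteq> f"
      by (simp add: * meet_le1 meet_right)
  qed (simp_all add: *)
qed

text \<open>The covers z \<or> (z \<rightarrow> x) and z \<or> (z \<rightarrow> y) share the trivial
  part z. What remains is (z \<rightarrow> x) \<and> (z \<rightarrow> y), whose meet with z is below
  x \<and> y.\<close>

lemma heyting_le_meet:
  assumes zx: "heyting_le z x" and zy: "heyting_le z y"
    and [simp]: "x \<in> carrier L" "y \<in> carrier L" "z \<in> carrier L"
  shows "heyting_le z (x \<sqinter> y)"
proof (rule heyting_leI)
  let ?f = "z \<squnion> (z \<rightharpoonup> (x \<sqinter> y))"
  have "(z \<rightharpoonup> x) \<sqinter> (z \<rightharpoonup> y) \<sqinter> z \<sqsubseteq> x \<sqinter> y"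
  proof (rule meet_le)
    have "(z \<rightharpoonup> x) \<sqinter> (z \<rightharpoonup> y) \<sqinter> z \<sqsubseteq> z \<sqinter> (z \<rightharpoonup> x)"
      by (simp add: meet_le meet_le1 meet_le2)
    then show "(z \<rightharpoonup> x) \<sqinter> (z \<rightharpoonup> y) \<sqinter> z \<sqsubseteq> x"
      by (rule le_trans) (simp_all add: meet_imp_le)
    have "(z \<rightharpoonup> x) \<sqinter> (z \<rightharpoonup> y) \<sqinter> z \<sqsubseteq> z \<sqinter> (z \<rightharpoonup> y)"
      by (simp add: meet_le meet_le1 meet_le2)
    then show "(z \<rightharpoonup> x) \<sqinter> (z \<rightharpoonup> y) \<sqinter> z \<sqsubseteq> y"
      by (rule le_trans) (simp_all add: meet_imp_le)
  qed simp_all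
  then have both: "(z \<rightharpoonup> x) \<sqinter> (z \<rightharpoonup> y) \<sqsubseteq> ?f"
    by (simp add: le_join_imp)
  have x: "z \<rightharpoonup> x \<sqsubseteq> ?f"
  proof (rule cut_dense)
    show "z \<rightharpoonup> x \<sqsubseteq> z \<squnion> (z \<rightharpoonup> y)"
      by (rule heyting_le_cover[OF zy]) simp_all
  qed (simp_all add: both le_join1 meet_le2)
  have "z \<squnion> (z \<rightharpoonup> x) \<sqsubseteq> ?f"
    using x by (simp add: join_le join_left)
  then show "\<top> \<sqsubseteq> ?f"
    using le_trans[OF heyting_le_cover[OF zx, of \<top>]] by simp
  fix a f
  assume a [simp]: "a \<in> carrier L" "f \<in> carrier L" and *: "a \<sqsubseteq> z" "a \<sqsubseteq> \<sim> \<sim> f" "a \<sqinter> (x \<sqinter> y) \<sqsubseteq> f"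
  show "a \<sqsubseteq> f"
  proof (rule heyting_leD[OF zx])
    have "a \<sqinter> x \<sqinter> y \<sqsubseteq> a \<sqinter> (x \<sqinter> y)"
      by (simp add: meet_le meet_le1 meet_le2)
    then have "a \<sqinter> x \<sqinter> y \<sqsubseteq> f"
      by (rule le_trans) (simp_all add: *)
    from heyting_leD[OF zy _ _ this] show "a \<sqinter> x \<sqsubseteq> f"
      by (simp add: * meet_le1)
  qed (simp_all add: *)
qed

text \<open>For lack of distributivity, the meet of \<open>?p\<close> with x \<or> y need not be
  below z. It is below z on each of the cases x and y, which is what
  \<open>le_join_imp_cases\<close> asks for. In the second condition \<open>cut\<close> splits a
  along x \<or> y.\<close>

lemma heyting_le_join:
  assumes xz: "heyting_le x z" and yz: "heyting_le y z"
    and [simp]: "x \<in> carrier L" "y \<in> carrier L" "z \<in> carrier L"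
  shows "heyting_le (x \<squnion> y) z"
proof (rule heyting_leI)
  let ?f = "(x \<squnion> y) \<squnion> ((x \<squnion> y) \<rightharpoonup> z)"
  let ?p = "(x \<rightharpoonup> z) \<sqinter> (y \<rightharpoonup> z)"
  have both: "?p \<sqsubseteq> ?f"
  proof (rule le_join_imp_cases)
    show "?p \<sqinter> (x \<squnion> y) \<sqsubseteq> x \<squnion> y"
      by (simp add: meet_le2)
    have "?p \<sqinter> (x \<squnion> y) \<sqinter> x \<sqsubseteq> x \<sqinter> (x \<rightharpoonup> z)"
      by (simp add: meet_le meet_le1 meet_le2)
    then show "?p \<sqinter> (x \<squnion> y) \<sqinter> x \<sqsubseteq> z"
      by (rule le_trans) (simp_all add: meet_imp_le)
    have "?p \<sqinter> (x \<squnion> y) \<sqinter> y \<sqsubseteq> y \<sqinter> (y \<rightharpoonup> z)"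
      by (simp add: meet_le meet_le1 meet_le2)
    then show "?p \<sqinter> (x \<squnion> y) \<sqinter> y \<sqsubseteq> z"
      by (rule le_trans) (simp_all add: meet_imp_le)
  qed simp_all
  have x: "x \<rightharpoonup> z \<sqsubseteq> ?f"
  proof (rule cut_dense)
    show "x \<rightharpoonup> z \<sqsubseteq> y \<squnion> (y \<rightharpoonup> z)"
      by (rule heyting_le_cover[OF yz]) simp_all
  qed (simp_all add: both le_join1 le_join2 meet_le2)
  have "x \<squnion> (x \<rightharpoonup> z) \<sqsubseteq> ?f"
    using x by (simp add: join_le le_join1)
  then show "\<top> \<sqsubseteq> ?f"
    using le_trans[OF heyting_le_cover[OF xz, of \<top>]] by simp
  fix a f
  assume a [simp]: "a \<in> carrier L" "f \<in> carrier L" and *: "a \<sqsubseteq> x \<squnion> y" "a \<sqsubseteq> \<sim> \<sim> f" "a \<sqinter> z \<sqsubseteq> f"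
  have "a \<sqinter> u \<sqsubseteq> f" if uz: "heyting_le u z" and [simp]: "u \<in> carrier L" for u
  proof (rule heyting_leD[OF uz])
    have "a \<sqinter> u \<sqinter> z \<sqsubseteq> a \<sqinter> z"
      by (simp add: meet_le meet_le1 meet_le2)
    then show "a \<sqinter> u \<sqinter> z \<sqsubseteq> f"
      by (rule le_trans) (simp_all add: *)
  qed (simp_all add: * meet_le1 meet_right)
  from this[OF xz] this[OF yz] show "a \<sqsubseteq> f"
    by (rule cut[OF *(1,2)]) simp_all
qed

text \<open>The harder half of residuation. The meet of \<open>?p\<close> with x is only known to be
  below y \<or> (y \<rightarrow> z), so both conditions are split along (x \<and> y) \<or>
  \<open>?p\<close> and, inside \<open>?p\<close>, along y \<or> (y \<rightarrow> z). Where y and z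
  are both available, y \<and> z \<le> y \<rightarrow> z finishes.\<close>

lemma heyting_le_imp:
  assumes xy: "heyting_le (x \<sqinter> y) z"
    and [simp]: "x \<in> carrier L" "y \<in> carrier L" "z \<in> carrier L"
  shows "heyting_le x (y \<rightharpoonup> z)"
proof (rule heyting_leI)
  let ?f = "x \<squnion> (x \<rightharpoonup> (y \<rightharpoonup> z))"
  let ?p = "(x \<sqinter> y) \<rightharpoonup> z"
  have top: "\<top> \<sqsubseteq> (x \<sqinter> y) \<squnion> ?p"
    by (rule heyting_le_cover[OF xy]) simp_all
  have "?p \<sqinter> x \<sqinter> y \<sqsubseteq> (x \<sqinter> y) \<sqinter> ?p"
    by (simp add: meet_le meet_le1 meet_le2)
  then have pz: "?p \<sqinter> x \<sqinter> y \<sqsubseteq> z"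
    by (rule le_trans) (simp_all add: meet_imp_le)
  then have "?p \<sqinter> x \<sqinter> y \<sqsubseteq> y \<sqinter> z"
    by (simp add: meet_le meet_right)
  then have pyz: "?p \<sqinter> x \<sqinter> y \<sqsubseteq> y \<rightharpoonup> z"
    by (rule le_trans) (simp_all add: meet_le_imp)
  have px: "?p \<sqinter> x \<sqsubseteq> y \<squnion> (y \<rightharpoonup> z)"
    using pz by (simp add: le_join_imp)
  have "?p \<sqsubseteq> ?f"
    by (rule le_join_imp_cases[OF px pyz]) (simp_all add: meet_le2)
  then have "(x \<sqinter> y) \<squnion> ?p \<sqsubseteq> ?f"
    by (simp add: join_le le_join1 meet_le1)
  with top show "\<top> \<sqsubseteq> ?f"
    by (rule le_trans) simp_all
  fix a f
  assume a [simp]: "a \<in> carrier L" "f \<in> carrier L"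
    and *: "a \<sqsubseteq> x" "a \<sqsubseteq> \<sim> \<sim> f" "a \<sqinter> (y \<rightharpoonup> z) \<sqsubseteq> f"
  \<comment> \<open>This form of \<open>*(3)\<close> closes all three leaves of the nested
    cuts.\<close>
  have fI: "u \<sqsubseteq> f" if "u \<sqsubseteq> a" "u \<sqsubseteq> y \<rightharpoonup> z" and [simp]: "u \<in> carrier L" for u
    by (rule le_trans[OF meet_le[OF that(1,2)] *(3)]) simp_all
  show "a \<sqsubseteq> f"
  proof (rule cut)
    show "a \<sqsubseteq> (x \<sqinter> y) \<squnion> ?p"
      by (rule heyting_le_cover[OF xy]) simp_all
    show "a \<sqinter> (x \<sqinter> y) \<sqsubseteq> f"
    proof (rule heyting_leD[OF xy])
      show "a \<sqinter> (x \<sqinter> y) \<sqinter> z \<sqsubseteq> f"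
      proof (rule fI)
        have "a \<sqinter> (x \<sqinter> y) \<sqinter> z \<sqsubseteq> y \<sqinter> z"
          by (simp add: meet_le meet_le1 meet_le2)
        then show "a \<sqinter> (x \<sqinter> y) \<sqinter> z \<sqsubseteq> y \<rightharpoonup> z"
          by (rule le_trans) (simp_all add: meet_le_imp)
      qed (simp_all add: meet_le1)
    qed (simp_all add: * meet_le1 meet_right)
    show "a \<sqinter> ?p \<sqsubseteq> f"
    proof (rule cut)
      have ap: "a \<sqinter> ?p \<sqsubseteq> ?p \<sqinter> x"
        by (simp add: * meet_le meet_le1 meet_le2)
      then show "a \<sqinter> ?p \<sqsubseteq> y \<squnion> (y \<rightharpoonup> z)"
        using px by (rule le_trans) simp_all
      show "a \<sqinter> ?p \<sqinter> y \<sqsubseteq> f"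
      proof (rule fI)
        have "a \<sqinter> ?p \<sqinter> y \<sqsubseteq> ?p \<sqinter> x \<sqinter> y"
          using ap by (simp add: meet_le meet_le1 meet_right)
        then show "a \<sqinter> ?p \<sqinter> y \<sqsubseteq> y \<rightharpoonup> z"
          using pyz by (rule le_trans) simp_all
      qed (simp_all add: meet_le1)
      show "a \<sqinter> ?p \<sqinter> (y \<rightharpoonup> z) \<sqsubseteq> f"
        by (rule fI) (simp_all add: meet_le1 meet_right)
    qed (simp_all add: * meet_le1)
  qed (simp_all add: *)
qed

lemma heyting_le_residuation:
  assumes [simp]: "x \<in> carrier L" "y \<in> carrier L" "z \<in> carrier L"
  shows "heyting_le (x \<sqinter> y) z \<longleftrightarrow> heyting_le x (y \<rightharpoonup> z)"
proof
  assume *: "heyting_le x (y \<rightharpoonup> z)"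
  have "heyting_le (x \<sqinter> y) (y \<rightharpoonup> z)"
    by (rule heyting_le_trans[OF _ *]) (simp_all add: le_imp_heyting_le meet_left)
  then have "heyting_le (x \<sqinter> y) (y \<sqinter> (y \<rightharpoonup> z))"
    by (simp add: heyting_le_meet le_imp_heyting_le meet_right)
  then show "heyting_le (x \<sqinter> y) z"
    by (rule heyting_le_trans) (simp_all add: le_imp_heyting_le meet_imp_le)
qed (simp add: heyting_le_imp)

lemma heyting_le_antisym:
  assumes "heyting_le x y" "x \<sqsubseteq> \<sim> \<sim> y" and "x \<in> carrier L" "y \<in> carrier L"
  shows "x \<sqsubseteq> y"
  by (rule heyting_leD[OF assms(1) _ assms(2)]) (simp_all add: assms meet_right)

end

section \<open>Quotients by a congruence preorder\<close>

definition principal_set :: "[_, 'a \<Rightarrow> 'a \<Rightarrow> bool, 'a] \<Rightarrow> 'a set"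
  where "principal_set L r x = {y \<in> carrier L. r y x}"

text \<open>
  The quotient by the equivalence generated by a preorder; the class of \<open>x\<close> is encoded by the
  set of elements below \<open>x\<close>, which turns the order into inclusion.
\<close>

definition fund_quot :: "[('a, 'm) fund_alg_scheme, 'a \<Rightarrow> 'a \<Rightarrow> bool] \<Rightarrow> 'a set fund_alg"
  where "fund_quot L r =
    \<lparr>carrier = principal_set L r ` carrier L, eq = (=), le = (\<subseteq>),
     imp = (\<lambda>A B. principal_set L r
       (inv_into (carrier L) (principal_set L r) A \<rightharpoonup>\<^bsub>L\<^esub>
        inv_into (carrier L) (principal_set L r) B))\<rparr>"

text \<open>Compatibility with \<rightarrow> is asked for equivalent arguments only: the Sasaki
  implication of an orthomodular algebra is in general not antitone in its first argument.\<close>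

locale fund_congruence_preorder = fundamental_algebra +
  fixes r :: "'a \<Rightarrow> 'a \<Rightarrow> bool"
  assumes r_le: "\<lbrakk>x \<sqsubseteq> y; x \<in> carrier L; y \<in> carrier L\<rbrakk> \<Longrightarrow> r x y"
    and r_trans: "\<lbrakk>r x y; r y z; x \<in> carrier L; y \<in> carrier L; z \<in> carrier L\<rbrakk> \<Longrightarrow> r x z"
    and r_meet: "\<lbrakk>r z x; r z y; x \<in> carrier L; y \<in> carrier L; z \<in> carrier L\<rbrakk> \<Longrightarrow> r z (x \<sqinter> y)"
    and r_join: "\<lbrakk>r x z; r y z; x \<in> carrier L; y \<in> carrier L; z \<in> carrier L\<rbrakk> \<Longrightarrow> r (x \<squnion> y) z"
    and r_imp: "\<lbrakk>r x x'; r x' x; r y y'; r y' y;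
        x \<in> carrier L; x' \<in> carrier L; y \<in> carrier L; y' \<in> carrier L\<rbrakk> \<Longrightarrow> r (x \<rightharpoonup> y) (x' \<rightharpoonup> y')"
begin

abbreviation quot ("Q") where "Q \<equiv> fund_quot L r"

abbreviation cls where "cls \<equiv> principal_set L r"

lemma carrier_quot: "carrier Q = cls ` carrier L"
  by (simp add: fund_quot_def)

lemma cls_closed [simp]: "x \<in> carrier L \<Longrightarrow> cls x \<in> carrier Q"
  by (simp add: carrier_quot)

lemma eq_quot: "(.=\<^bsub>Q\<^esub>) = (=)"
  by (simp add: fund_quot_def)

lemma le_quot: "A \<sqsubseteq>\<^bsub>Q\<^esub> B \<longleftrightarrow> A \<subseteq> B"
  by (simp add: fund_quot_def)

lemma cls_subset_iff: "\<lbrakk>x \<in> carrier L; y \<in> carrier L\<rbrakk> \<Longrightarrow> cls x \<subseteq> cls y \<longleftrightarrow> r x y"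
  unfolding principal_set_def using r_le[of x x] le_refl[of x] r_trans by blast

lemma cls_le_iff: "\<lbrakk>x \<in> carrier L; y \<in> carrier L\<rbrakk> \<Longrightarrow> cls x \<sqsubseteq>\<^bsub>Q\<^esub> cls y \<longleftrightarrow> r x y"
  by (simp add: le_quot cls_subset_iff)

lemma cls_eq_iff: "\<lbrakk>x \<in> carrier L; y \<in> carrier L\<rbrakk> \<Longrightarrow> cls x = cls y \<longleftrightarrow> r x y \<and> r y x"
  using cls_subset_iff by blast

text \<open>The representatives picked by \<open>inv_into\<close> are equivalent to x and y, so
  \<open>r_imp\<close>, used in both directions, makes the choice immaterial.\<close>

lemma cls_imp:
  assumes "x \<in> carrier L" "y \<in> carrier L"
  shows "cls x \<rightharpoonup>\<^bsub>Q\<^esub> cls y = cls (x \<rightharpoonup> y)"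
proof -
  define x' y' where "x' = inv_into (carrier L) cls (cls x)" and "y' = inv_into (carrier L) cls (cls y)"
  have "x' \<in> carrier L" "y' \<in> carrier L" "cls x' = cls x" "cls y' = cls y"
    using assms by (simp_all add: x'_def y'_def inv_into_into f_inv_into_f)
  moreover have "cls x \<rightharpoonup>\<^bsub>Q\<^esub> cls y = cls (x' \<rightharpoonup> y')"
    by (simp add: fund_quot_def x'_def y'_def)
  ultimately show ?thesis
    using assms by (simp add: cls_eq_iff r_imp)
qed

lemma partial_order_quot: "partial_order Q"
  by unfold_locales (auto simp: eq_quot le_quot)

lemma cls_join_least:
  assumes [simp]: "x \<in> carrier L" "y \<in> carrier L"
  shows "least Q (cls (x \<squnion> y)) (Upper Q {cls x, cls y})"
proof (rule least_UpperI)
  fix A assume "A \<in> {cls x, cls y}"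
  then show "A \<sqsubseteq>\<^bsub>Q\<^esub> cls (x \<squnion> y)"
    by (auto simp: cls_le_iff r_le join_left join_right)
next
  fix A assume A: "A \<in> Upper Q {cls x, cls y}"
  then obtain z where z: "z \<in> carrier L" "A = cls z"
    unfolding Upper_def carrier_quot by blast
  from A have "cls x \<sqsubseteq>\<^bsub>Q\<^esub> A" "cls y \<sqsubseteq>\<^bsub>Q\<^esub> A"
    by (auto simp: Upper_def)
  with z show "cls (x \<squnion> y) \<sqsubseteq>\<^bsub>Q\<^esub> A"
    by (simp add: cls_le_iff r_join)
qed simp_all

lemma cls_meet_greatest:
  assumes [simp]: "x \<in> carrier L" "y \<in> carrier L"
  shows "greatest Q (cls (x \<sqinter> y)) (Lower Q {cls x, cls y})"
proof (rule greatest_LowerI)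
  fix A assume "A \<in> {cls x, cls y}"
  then show "cls (x \<sqinter> y) \<sqsubseteq>\<^bsub>Q\<^esub> A"
    by (auto simp: cls_le_iff r_le meet_left meet_right)
next
  fix A assume A: "A \<in> Lower Q {cls x, cls y}"
  then obtain z where z: "z \<in> carrier L" "A = cls z"
    unfolding Lower_def carrier_quot by blast
  from A have "A \<sqsubseteq>\<^bsub>Q\<^esub> cls x" "A \<sqsubseteq>\<^bsub>Q\<^esub> cls y"
    by (auto simp: Lower_def)
  with z show "A \<sqsubseteq>\<^bsub>Q\<^esub> cls (x \<sqinter> y)"
    by (simp add: cls_le_iff r_meet)
qed simp_all

lemma cls_bottom_least: "least Q (cls \<bottom>) (carrier Q)"
  by (auto simp: least_def carrier_quot cls_le_iff r_le)

lemma cls_top_greatest: "greatest Q (cls \<top>) (carrier Q)"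
  by (auto simp: greatest_def carrier_quot cls_le_iff r_le)

lemma bounded_lattice_quot: "bounded_lattice Q"
proof -
  interpret Q: partial_order Q by (fact partial_order_quot)
  show ?thesis
  proof
    fix A B assume "A \<in> carrier Q" "B \<in> carrier Q"
    then obtain x y where "x \<in> carrier L" "A = cls x" "y \<in> carrier L" "B = cls y"
      unfolding carrier_quot by blast
    then show "\<exists>s. least Q s (Upper Q {A, B})" "\<exists>s. greatest Q s (Lower Q {A, B})"
      using cls_join_least cls_meet_greatest by blast+
  qed (rule exI, rule cls_bottom_least cls_top_greatest)+
qed

sublocale Q: bounded_lattice Q
  by (fact bounded_lattice_quot)

lemma cls_join:
  assumes "x \<in> carrier L" "y \<in> carrier L"
  shows "cls (x \<squnion> y) = cls x \<squnion>\<^bsub>Q\<^esub> cls y"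
  using cls_join_least[OF assms] unfolding join_def sup_def
  by (metis Q.least_unique someI)

lemma cls_meet:
  assumes "x \<in> carrier L" "y \<in> carrier L"
  shows "cls (x \<sqinter> y) = cls x \<sqinter>\<^bsub>Q\<^esub> cls y"
  using cls_meet_greatest[OF assms] unfolding meet_def inf_def
  by (metis Q.greatest_unique someI)

lemma cls_bottom: "cls \<bottom> = \<bottom>\<^bsub>Q\<^esub>"
  by (rule Q.least_unique[OF cls_bottom_least Q.bottom_least])

lemma cls_top: "cls \<top> = \<top>\<^bsub>Q\<^esub>"
  by (rule Q.greatest_unique[OF cls_top_greatest Q.top_greatest])

lemma cls_neg: "x \<in> carrier L \<Longrightarrow> \<sim>\<^bsub>Q\<^esub> cls x = cls (\<sim> x)"
  by (simp add: neg_def cls_imp flip: cls_bottom)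

lemmas cls_simps = cls_imp cls_neg cls_meet[symmetric] cls_join[symmetric]
  cls_bottom[symmetric] cls_top[symmetric]

text \<open>\<open>r_imp\<close> needs equivalent arguments, while x and y are related one way only.
  The element x \<and> y is equivalent to x and truly below y, so antitonicity in L applies to
  it.\<close>

lemma r_neg:
  assumes "r x y" and [simp]: "x \<in> carrier L" "y \<in> carrier L"
  shows "r (\<sim> y) (\<sim> x)"
proof -
  have xy: "r x (x \<sqinter> y)" "r (x \<sqinter> y) x"
    using assms by (simp_all add: r_meet r_le meet_left)
  have "r (\<sim> y) (\<sim> (x \<sqinter> y))"
    by (simp add: r_le neg_antitone meet_right)
  moreover have "r (\<sim> (x \<sqinter> y)) (\<sim> x)"
    unfolding neg_def by (rule r_imp) (simp_all add: xy r_le)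
  ultimately show ?thesis
    by (rule r_trans) simp_all
qed

lemma fundamental_algebra_quot: "fundamental_algebra Q"
  by unfold_locales
    (auto simp: carrier_quot cls_simps cls_le_iff r_neg r_le le_neg_neg meet_neg)

lemma cls_hom: "cls \<in> fund_hom L Q"
  by (simp add: fund_hom_def cls_simps)

end

text \<open>Elements with equal classes in both quotients are related both ways by r and by s, so
  \<open>antisym\<close> gives injectivity. Quotient maps are onto, which makes the embedding
  subdirect.\<close>

lemma subdirect_embedding_quot:
  assumes "fund_congruence_preorder L r" "fund_congruence_preorder L s"
    and antisym: "\<And>x y. \<lbrakk>x \<in> carrier L; y \<in> carrier L; r x y; s x y\<rbrakk> \<Longrightarrow> x \<sqsubseteq>\<^bsub>L\<^esub> y"
  shows "subdirect_embedding L (fund_quot L r) (fund_quot L s)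
    (\<lambda>x. (principal_set L r x, principal_set L s x))" (is "subdirect_embedding L ?A ?B ?h")
proof -
  interpret r: fund_congruence_preorder L r by fact
  interpret s: fund_congruence_preorder L s by fact
  note prod = fund_prod_meet fund_prod_join fund_prod_bottom fund_prod_top
  note prod = prod[OF r.fundamental_algebra_quot s.fundamental_algebra_quot]
  have "?h \<in> fund_hom L (fund_prod ?A ?B)"
    using r.cls_hom s.cls_hom by (simp add: fund_hom_def prod Pi_iff)
  moreover have "inj_on ?h (carrier L)"
    by (intro inj_onI r.le_antisym) (simp_all add: antisym r.cls_eq_iff s.cls_eq_iff)
  ultimately show ?thesis
    by (simp add: subdirect_embedding_def image_comp[symmetric] r.carrier_quot s.carrier_quot
        comp_def)
qed

section \<open>The two quotients of an Ex-algebra\<close>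

context ex_algebra
begin

text \<open>Meets rest on (iEx) and joins are immediate. For the implication, (nS) replaces x
  \<rightarrow> y by \<not>x \<or> (x \<and> y) under double negation, and each joinand is
  compatible.\<close>

lemma orthomodular_preorder: "fund_congruence_preorder L (\<lambda>x y. x \<sqsubseteq> \<sim> \<sim> y)"
proof -
  have le: "x \<sqsubseteq> \<sim> \<sim> y" if "x \<sqsubseteq> y" "x \<in> carrier L" "y \<in> carrier L" for x y
    using that by (meson le_neg_neg le_trans neg_closed)
  have trans: "x \<sqsubseteq> \<sim> \<sim> z"
    if "x \<sqsubseteq> \<sim> \<sim> y" "y \<sqsubseteq> \<sim> \<sim> z" "x \<in> carrier L" "y \<in> carrier L" "z \<in> carrier L" for x y z
    using that neg_neg_mono[of y "\<sim> \<sim> z"] by (metis le_trans neg_closed neg_neg_neg)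
  have meet: "z \<sqsubseteq> \<sim> \<sim> (x \<sqinter> y)"
    if "z \<sqsubseteq> \<sim> \<sim> x" "z \<sqsubseteq> \<sim> \<sim> y" and [simp]: "x \<in> carrier L" "y \<in> carrier L" "z \<in> carrier L"
    for x y z
  proof (rule trans)
    \<comment> \<open>\<open>le_neg_neg_meet\<close> strips the double negation from one factor
      only, so it is used twice, the second time with the factors swapped.\<close>
    show "z \<sqsubseteq> \<sim> \<sim> (\<sim> \<sim> x \<sqinter> y)"
      using that(1,2) by (rule le_neg_neg_meet) simp_all
    have "\<sim> \<sim> x \<sqinter> y \<sqsubseteq> \<sim> \<sim> (y \<sqinter> x)"
      by (rule le_neg_neg_meet) (simp_all add: meet_left meet_right)
    then show "\<sim> \<sim> x \<sqinter> y \<sqsubseteq> \<sim> \<sim> (x \<sqinter> y)"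
      by (simp add: meet_comm)
  qed simp_all
  have imp: "x \<rightharpoonup> y \<sqsubseteq> \<sim> \<sim> (x' \<rightharpoonup> y')"
    if r: "x \<sqsubseteq> \<sim> \<sim> x'" "x' \<sqsubseteq> \<sim> \<sim> x" "y \<sqsubseteq> \<sim> \<sim> y'" "y' \<sqsubseteq> \<sim> \<sim> y"
      and [simp]: "x \<in> carrier L" "x' \<in> carrier L" "y \<in> carrier L" "y' \<in> carrier L" for x x' y y'
  proof -
    have "\<sim> x \<sqsubseteq> \<sim> x'"
      using le_neg_swap[OF r(2)] by simp
    then have neg: "\<sim> x \<sqsubseteq> \<sim> \<sim> (\<sim> x' \<squnion> (x' \<sqinter> y'))"
      by (simp add: le le_join1)
    have "x \<sqinter> y \<sqsubseteq> \<sim> \<sim> x'" "x \<sqinter> y \<sqsubseteq> \<sim> \<sim> y'"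
      using r by (simp_all add: meet_le1 meet_le2)
    then have "x \<sqinter> y \<sqsubseteq> \<sim> \<sim> (x' \<sqinter> y')"
      by (rule meet) simp_all
    then have "x \<sqinter> y \<sqsubseteq> \<sim> \<sim> (\<sim> x' \<squnion> (x' \<sqinter> y'))"
      by (rule trans) (simp_all add: le join_right)
    with neg have *: "\<sim> x \<squnion> (x \<sqinter> y) \<sqsubseteq> \<sim> \<sim> (x' \<rightharpoonup> y')"
      by (simp add: nS join_le)
    have "x \<rightharpoonup> y \<sqsubseteq> \<sim> \<sim> (\<sim> x \<squnion> (x \<sqinter> y))"
      by (simp add: le_neg_neg flip: nS)
    then show ?thesis
      using * by (rule trans) simp_all
  qed
  show ?thesis
    by unfold_locales (fact le trans meet imp | simp add: join_le)+
qed

text \<open>By residuation it suffices to get \<open>?p\<close> below y'. In \<open>?p\<close> one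
  may pass from x' to x, and residuation then leads to y.\<close>

lemma heyting_preorder: "fund_congruence_preorder L heyting_le"
proof
  fix x x' y y'
  assume [simp]: "x \<in> carrier L" "x' \<in> carrier L" "y \<in> carrier L" "y' \<in> carrier L"
    and r: "heyting_le x x'" "heyting_le x' x" "heyting_le y y'" "heyting_le y' y"
  let ?p = "(x \<rightharpoonup> y) \<sqinter> x'"
  have "heyting_le ?p x"
    by (rule heyting_le_trans[OF _ r(2)]) (simp_all add: le_imp_heyting_le meet_right)
  then have "heyting_le ?p ((x \<rightharpoonup> y) \<sqinter> x)"
    by (simp add: heyting_le_meet le_imp_heyting_le meet_left)
  moreover have "heyting_le ((x \<rightharpoonup> y) \<sqinter> x) y"
    by (simp add: heyting_le_residuation le_imp_heyting_le)
  ultimately have "heyting_le ?p y"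
    by (rule heyting_le_trans) simp_all
  then have "heyting_le ?p y'"
    using r(3) by (rule heyting_le_trans) simp_all
  then show "heyting_le (x \<rightharpoonup> y) (x' \<rightharpoonup> y')"
    by (simp add: heyting_le_residuation)
qed (fact le_imp_heyting_le heyting_le_trans heyting_le_meet heyting_le_join)+

lemma orthomodular_algebra_quot: "orthomodular_algebra (fund_quot L (\<lambda>x y. x \<sqsubseteq> \<sim> \<sim> y))"
proof -
  interpret r: fund_congruence_preorder L "\<lambda>x y. x \<sqsubseteq> \<sim> \<sim> y"
    by (fact orthomodular_preorder)
  interpret Q: fundamental_algebra "fund_quot L (\<lambda>x y. x \<sqsubseteq> \<sim> \<sim> y)"
    by (fact r.fundamental_algebra_quot)
  show ?thesis
  proof
    fix A assume "A \<in> carrier r.quot"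
    then obtain x where x: "x \<in> carrier L" "A = r.cls x"
      unfolding r.carrier_quot by blast
    then show "\<sim>\<^bsub>r.quot\<^esub> \<sim>\<^bsub>r.quot\<^esub> A = A"
      by (simp add: r.cls_neg r.cls_eq_iff le_neg_neg neg_neg_neg)
    fix B assume "B \<in> carrier r.quot"
    then obtain y where y: "y \<in> carrier L" "B = r.cls y"
      unfolding r.carrier_quot by blast
    have "r.cls (x \<sqinter> (x \<rightharpoonup> y)) \<sqsubseteq>\<^bsub>r.quot\<^esub> r.cls y"
      using x y by (simp only: r.cls_le_iff meet_closed imp_closed) (simp add: r.r_le meet_imp_le)
    then show "A \<sqinter>\<^bsub>r.quot\<^esub> (A \<rightharpoonup>\<^bsub>r.quot\<^esub> B) \<sqsubseteq>\<^bsub>r.quot\<^esub> B"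
      using x y by (simp add: r.cls_imp flip: r.cls_meet)
    \<comment> \<open>By (nS) the two sides have the same double negation, hence the same class,
      though they may differ in L.\<close>
    have "x \<rightharpoonup> y \<sqsubseteq> \<sim> \<sim> (\<sim> x \<squnion> (x \<sqinter> y))" "\<sim> x \<squnion> (x \<sqinter> y) \<sqsubseteq> \<sim> \<sim> (x \<rightharpoonup> y)"
      using x y le_neg_neg[of "x \<rightharpoonup> y"] le_neg_neg[of "\<sim> x \<squnion> (x \<sqinter> y)"] by (simp_all add: nS)
    then have "r.cls (x \<rightharpoonup> y) = r.cls (\<sim> x \<squnion> (x \<sqinter> y))"
      using x y by (simp add: r.cls_eq_iff)
    then show "A \<rightharpoonup>\<^bsub>r.quot\<^esub> B = \<sim>\<^bsub>r.quot\<^esub> A \<squnion>\<^bsub>r.quot\<^esub> (A \<sqinter>\<^bsub>r.quot\<^esub> B)"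
      using x y by (simp add: r.cls_imp r.cls_neg r.cls_meet r.cls_join)
  qed
qed

lemma heyting_algebra_quot: "heyting_algebra (fund_quot L heyting_le)"
proof -
  interpret r: fund_congruence_preorder L heyting_le
    by (fact heyting_preorder)
  interpret Q: fundamental_algebra "fund_quot L heyting_le"
    by (fact r.fundamental_algebra_quot)
  show ?thesis
  proof
    fix A B C assume "A \<in> carrier r.quot" "B \<in> carrier r.quot" "C \<in> carrier r.quot"
    then obtain x y z where "x \<in> carrier L" "A = r.cls x" "y \<in> carrier L" "B = r.cls y"
      "z \<in> carrier L" "C = r.cls z"
      unfolding r.carrier_quot by blast
    then show "C \<sqinter>\<^bsub>r.quot\<^esub> A \<sqsubseteq>\<^bsub>r.quot\<^esub> B \<longleftrightarrow> C \<sqsubseteq>\<^bsub>r.quot\<^esub> A \<rightharpoonup>\<^bsub>r.quot\<^esub> B"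
      by (simp add: r.cls_imp r.cls_le_iff heyting_le_residuation flip: r.cls_meet)
  qed
qed

end

theorem theorem3p1:
  fixes L :: "('a, 'm) fund_alg_scheme"
  assumes "ex_algebra L"
  shows "\<exists>(O_L :: 'a set fund_alg) (I_L :: 'a set fund_alg) (e :: 'a \<Rightarrow> 'a set \<times> 'a set).
    orthomodular_algebra O_L \<and> heyting_algebra I_L \<and> subdirect_embedding L O_L I_L e"
proof -
  interpret ex_algebra L by fact
  have "subdirect_embedding L (fund_quot L (\<lambda>x y. x \<sqsubseteq>\<^bsub>L\<^esub> \<sim>\<^bsub>L\<^esub> \<sim>\<^bsub>L\<^esub> y)) (fund_quot L heyting_le)
    (\<lambda>x. (principal_set L (\<lambda>x y. x \<sqsubseteq>\<^bsub>L\<^esub> \<sim>\<^bsub>L\<^esub> \<sim>\<^bsub>L\<^esub> y) x, principal_set L heyting_le x))"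
    by (rule subdirect_embedding_quot[OF orthomodular_preorder heyting_preorder])
      (rule heyting_le_antisym)
  with orthomodular_algebra_quot heyting_algebra_quot show ?thesis
    by (intro exI conjI)
qed

end
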